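(* Let $G$ be a finite group and let $K\lessdot M\lessdot G$. If $K_G\ne M_G$, then $K$ is a strictly $2$-maximal subgroup of $G$. In particular, if a maximal subgroup $M$ of $G$ is normal in $G$, then every maximal subgroup of $M$ is a strictly $2$-maximal subgroup of $G$.
   Context: All groups are finite. A subgroup $M$ of a group $G$ is maximal, written $M\lessdot G$, if $M<G$ (proper) and $M\le H\le G$ implies $H=M$ or $H=G$. For a subgroup $H\le G$, $\mathrm{Max}(G,H)=\{M\lessdot G\mid H\le M\}$ is the set of maximal subgroups of $G$ containing $H$. A proper subgroup $H$ of $G$ is called strictly $2$-maximal in $G$ if $H\lessdot M$ for all $M\in \mathrm{Max}(G,H)$. For $H\le G$, $H_G=\bigcap_{g\in G}H^g$ denotes the core of $H$ in $G$ (the largest normal subgroup of $G$ contained in $H$). *)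

theory Defs
  imports "HOL-Algebra.Coset"
begin

definition maximal_subgroup :: "'a set \<Rightarrow> ('a, 'b) monoid_scheme \<Rightarrow> bool"
  where "maximal_subgroup M G \<longleftrightarrow>
    subgroup M G \<and> M \<noteq> carrier G \<and>
    (\<forall>H. subgroup H G \<and> M \<subseteq> H \<longrightarrow> H = M \<or> H = carrier G)"

definition maximal_subgroups_above :: "('a, 'b) monoid_scheme \<Rightarrow> 'a set \<Rightarrow> 'a set set"
  where "maximal_subgroups_above G H = {M. maximal_subgroup M G \<and> H \<subseteq> M}"

text \<open>The conjugate of \<open>H\<close> by \<open>g\<close> is \<open>g\<^sup>-\<^sup>1Hg\<close>.\<close>

definition conjugate_subset :: "('a, 'b) monoid_scheme \<Rightarrow> 'a set \<Rightarrow> 'a \<Rightarrow> 'a set"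
  where "conjugate_subset G H g = (inv\<^bsub>G\<^esub> g <#\<^bsub>G\<^esub> H) #>\<^bsub>G\<^esub> g"

definition core :: "('a, 'b) monoid_scheme \<Rightarrow> 'a set \<Rightarrow> 'a set"
  where "core G H = (\<Inter>g\<in>carrier G. conjugate_subset G H g)"

text \<open>A subgroup \<open>M\<close> of \<open>G\<close>, regarded as a group in its own right, is \<open>G\<lparr>carrier := M\<rparr>\<close>.\<close>

definition strictly_2_maximal :: "'a set \<Rightarrow> ('a, 'b) monoid_scheme \<Rightarrow> bool"
  where "strictly_2_maximal H G \<longleftrightarrow>
    subgroup H G \<and> H \<noteq> carrier G \<and>
    (\<forall>M \<in> maximal_subgroups_above G H. maximal_subgroup H (G\<lparr>carrier := M\<rparr>))"

end

theory Submission
  imports Defs "HOL-Algebra.Zassenhaus"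
begin

text \<open>
  Put \<open>N = core G M\<close>, a normal subgroup of \<open>G\<close> inside \<open>M\<close>. If \<open>N\<close> were contained in \<open>K\<close>, it
  would be contained in \<open>core G K\<close>, and the two cores would agree; so \<open>N\<close> is not contained
  in \<open>K\<close>, and maximality of \<open>K\<close> in \<open>M\<close> forces \<open>N K = M\<close>. Now let \<open>L \<noteq> M\<close> be maximal
  in \<open>G\<close> and contain \<open>K\<close>. Then \<open>L \<inter> M = K\<close> because \<open>K\<close> is maximal in \<open>M\<close>.
  For \<open>X\<close> between \<open>K\<close> and \<open>L\<close>, the subgroup \<open>N X\<close> contains \<open>N K = M\<close>, hence is \<open>M\<close> or \<open>G\<close>.
  In the first case \<open>X \<subseteq> L \<inter> M = K\<close>; in the second case the Dedekind law gives \<open>L = (L \<inter> N) X = X\<close>, as \<open>L \<inter> N \<subseteq> K \<subseteq> X\<close>.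
  The argument is \<open>strictly_2_maximal_if_normal_not_below\<close>. When \<open>M\<close> itself is normal, it is
  its own core, so it serves as \<open>N\<close> directly.
\<close>

context group
begin

lemma maximal_subgroup_in_subgroup_iff:
  assumes "subgroup M G"
  shows "maximal_subgroup K (G\<lparr>carrier := M\<rparr>) \<longleftrightarrow>
    subgroup K G \<and> K \<subset> M \<and> (\<forall>X. subgroup X G \<and> K \<subseteq> X \<and> X \<subseteq> M \<longrightarrow> X = K \<or> X = M)"
proof -
  have sub: "subgroup X (G\<lparr>carrier := M\<rparr>) \<longleftrightarrow> subgroup X G \<and> X \<subseteq> M" for X
    using incl_subgroup[OF assms] subgroup_incl[OF _ assms] subgroup.subset by fastforce
  show ?thesis
    unfolding maximal_subgroup_def sub by auto
qed

lemma inv_cancel_left: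
  assumes "x \<in> carrier G" "y \<in> carrier G"
  shows "inv x \<otimes> (x \<otimes> y) = y" "x \<otimes> (inv x \<otimes> y) = y"
  using assms by (simp_all flip: m_assoc)

lemma mem_core_iff:
  assumes "subgroup H G"
  shows "x \<in> core G H \<longleftrightarrow> x \<in> carrier G \<and> (\<forall>g\<in>carrier G. g \<otimes> x \<otimes> inv g \<in> H)"
proof -
  note H = subgroup.mem_carrier[OF assms]
  have conj: "x \<in> conjugate_subset G H g \<longleftrightarrow> x \<in> carrier G \<and> g \<otimes> x \<otimes> inv g \<in> H"
    if g: "g \<in> carrier G" for g
  proof
    assume "x \<in> conjugate_subset G H g"
    then obtain h where h: "h \<in> H" and x: "x = inv g \<otimes> h \<otimes> g"
      by (auto simp: conjugate_subset_def l_coset_def r_coset_def)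
    have "g \<otimes> x \<otimes> inv g = h"
      using g H[OF h] unfolding x by (simp add: m_assoc inv_cancel_left)
    then show "x \<in> carrier G \<and> g \<otimes> x \<otimes> inv g \<in> H"
      using g H[OF h] h x by simp
  next
    assume x: "x \<in> carrier G \<and> g \<otimes> x \<otimes> inv g \<in> H"
    then have "inv g \<otimes> (g \<otimes> x \<otimes> inv g) \<otimes> g = x"
      using g by (simp add: m_assoc inv_cancel_left)
    then show "x \<in> conjugate_subset G H g"
      using x by (force simp: conjugate_subset_def l_coset_def r_coset_def)
  qed
  then show ?thesis
    unfolding core_def using one_closed by blast
qed

lemma core_subset:
  assumes "subgroup H G"
  shows "core G H \<subseteq> H"
proof
  fix x assume "x \<in> core G H"
  then have "x \<in> carrier G" "\<one> \<otimes> x \<otimes> inv \<one> \<in> H"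
    using one_closed unfolding mem_core_iff[OF assms] by blast+
  then show "x \<in> H" by simp
qed

lemma core_mono:
  assumes "subgroup H G" "subgroup J G" "H \<subseteq> J"
  shows "core G H \<subseteq> core G J"
  unfolding subset_iff mem_core_iff[OF assms(1)] mem_core_iff[OF assms(2)]
  using assms(3) by blast

lemma normal_subset_core:
  assumes "N \<lhd> G" "subgroup H G" "N \<subseteq> H"
  shows "N \<subseteq> core G H"
proof
  fix x assume "x \<in> N"
  then have "x \<in> carrier G" "\<forall>g\<in>carrier G. g \<otimes> x \<otimes> inv g \<in> H"
    using subgroup.mem_carrier[OF normal_invE(1)] normal_invE(2) assms(1,3) by auto
  then show "x \<in> core G H"
    by (simp add: mem_core_iff[OF assms(2)])
qed

lemma core_normal:
  assumes H: "subgroup H G"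
  shows "core G H \<lhd> G"
proof (rule normal_invI)
  note mem = mem_core_iff[OF H]
  show "subgroup (core G H) G"
  proof (rule subgroupI)
    show "core G H \<subseteq> carrier G"
      by (auto simp: mem)
    show "core G H \<noteq> {}"
      using subgroup.one_closed[OF H] by (force simp: mem)
  next
    fix x assume x: "x \<in> core G H"
    have "g \<otimes> inv x \<otimes> inv g = inv (g \<otimes> x \<otimes> inv g)" if "g \<in> carrier G" for g
      using that x by (simp add: mem inv_mult_group m_assoc)
    then show "inv x \<in> core G H"
      using x subgroup.m_inv_closed[OF H] by (simp add: mem)
  next
    fix x y assume x: "x \<in> core G H" and y: "y \<in> core G H"
    have "g \<otimes> (x \<otimes> y) \<otimes> inv g = (g \<otimes> x \<otimes> inv g) \<otimes> (g \<otimes> y \<otimes> inv g)"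
      if "g \<in> carrier G" for g
      using that x y by (simp add: mem m_assoc inv_cancel_left)
    then show "x \<otimes> y \<in> core G H"
      using x y subgroup.m_closed[OF H] by (simp add: mem)
  qed
next
  fix a x assume a: "a \<in> carrier G" and x: "x \<in> core G H"
  have "g \<otimes> (a \<otimes> x \<otimes> inv a) \<otimes> inv g = (g \<otimes> a) \<otimes> x \<otimes> inv (g \<otimes> a)" if "g \<in> carrier G" for g
    using that a x by (simp add: mem_core_iff[OF H] inv_mult_group m_assoc)
  then show "a \<otimes> x \<otimes> inv a \<in> core G H"
    using a x by (simp add: mem_core_iff[OF H])
qed

lemma subsets_set_mult:
  assumes "subgroup H G" "subgroup J G"
  shows "H \<subseteq> H <#> J" "J \<subseteq> H <#> J"
proof -
  have "x \<otimes> \<one> \<in> H <#> J" if "x \<in> H" for x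
    using that subgroup.one_closed[OF assms(2)] by (auto simp: set_mult_def)
  then show "H \<subseteq> H <#> J"
    using subgroup.mem_carrier[OF assms(1)] by auto
  have "\<one> \<otimes> x \<in> H <#> J" if "x \<in> J" for x
    using that subgroup.one_closed[OF assms(1)] by (auto simp: set_mult_def)
  then show "J \<subseteq> H <#> J"
    using subgroup.mem_carrier[OF assms(2)] by auto
qed

lemma set_mult_subset_subgroup:
  assumes "subgroup L G" "A \<subseteq> L" "B \<subseteq> L"
  shows "A <#> B \<subseteq> L"
  using assms subgroup.m_closed[OF assms(1)] by (auto simp: set_mult_def)

text \<open>
  One inclusion of the Dedekind law. A factorisation \<open>l = n x\<close> of an element of \<open>L\<close> with
  \<open>x \<in> X \<subseteq> L\<close> has \<open>n = l x\<^sup>-\<^sup>1\<close> in \<open>L\<close>.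
\<close>

lemma Dedekind_law:
  assumes L: "subgroup L G" and N: "N \<subseteq> carrier G" and X: "X \<subseteq> L"
  shows "L \<inter> (N <#> X) \<subseteq> (L \<inter> N) <#> X"
proof
  fix l assume "l \<in> L \<inter> (N <#> X)"
  then obtain n x where l: "l \<in> L" "l = n \<otimes> x" and n: "n \<in> N" and x: "x \<in> X"
    by (auto simp: set_mult_def)
  have "n = l \<otimes> inv x"
    using l n x N X subgroup.mem_carrier[OF L] by (intro inv_solve_right[THEN iffD2]) auto
  moreover have "l \<otimes> inv x \<in> L"
    using l(1) x X subgroup.m_closed[OF L] subgroup.m_inv_closed[OF L] by blast
  ultimately have "n \<in> L" by simp
  then show "l \<in> (L \<inter> N) <#> X"
    using l n x by (auto simp: set_mult_def)
qed

text \<open>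
  A normal subgroup below \<open>M\<close> that escapes \<open>K\<close> is a supplement of \<open>K\<close> in \<open>M\<close>. Normality keeps
  products with it subgroups, so that the maximality of \<open>M\<close> applies to them.
\<close>

lemma strictly_2_maximal_if_normal_not_below:
  assumes M: "maximal_subgroup M G" and K: "maximal_subgroup K (G\<lparr>carrier := M\<rparr>)"
    and N: "N \<lhd> G" "N \<subseteq> M" "\<not> N \<subseteq> K"
  shows "strictly_2_maximal K G"
proof -
  have sM: "subgroup M G" "M \<noteq> carrier G"
    using M unfolding maximal_subgroup_def by blast+
  have maxM: "X = M \<or> X = carrier G" if "subgroup X G" "M \<subseteq> X" for X
    using M that unfolding maximal_subgroup_def by blast
  note K_iff = maximal_subgroup_in_subgroup_iff[OF sM(1)]
  have sK: "subgroup K G" "K \<subset> M"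
    using K unfolding K_iff by blast+
  have maxK: "X = K \<or> X = M" if "subgroup X G" "K \<subseteq> X" "X \<subseteq> M" for X
    using K that unfolding K_iff by blast
  note sN = normal_imp_subgroup[OF N(1)]
  have NK: "N <#> K = M"
    using maxK[OF mult_norm_subgroup[OF N(1) sK(1)]] subsets_set_mult[OF sN sK(1)]
      set_mult_subset_subgroup[OF sM(1) N(2)] sK(2) N(3) by blast
  have "maximal_subgroup K (G\<lparr>carrier := L\<rparr>)" if L: "maximal_subgroup L G" and KL: "K \<subseteq> L" for L
  proof (cases "L = M")
    case True
    then show ?thesis using K by simp
  next
    case False
    have sL: "subgroup L G" "L \<noteq> carrier G"
      using L by (simp_all add: maximal_subgroup_def)
    have not_ML: "\<not> M \<subseteq> L"
      using maxM[OF sL(1)] sL(2) False by blast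
    have "\<not> L \<subseteq> M"
      using L False sM unfolding maximal_subgroup_def by blast
    then have ne: "K \<noteq> L"
      using sK(2) by blast
    have inter: "L \<inter> M = K"
      using maxK[OF subgroups_Inter_pair[OF sL(1) sM(1)]] KL sK(2) not_ML by blast
    have "X = K \<or> X = L" if X: "subgroup X G" "K \<subseteq> X" "X \<subseteq> L" for X
    proof -
      note XN = subsets_set_mult[OF sN X(1)]
      have "M \<subseteq> N <#> X"
        unfolding NK[symmetric] using X(2) by (rule mono_set_mult[OF order_refl])
      then consider "N <#> X = M" | "N <#> X = carrier G"
        using maxM[OF mult_norm_subgroup[OF N(1) X(1)]] by blast
      then show ?thesis
      proof cases
        case 1
        then show ?thesis using XN(2) X inter by blast
      next
        case 2
        have "L \<subseteq> (L \<inter> N) <#> X"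
          using Dedekind_law[OF sL(1) subgroup.subset[OF sN] X(3)] subgroup.subset[OF sL(1)] 2
          by blast
        also have "\<dots> \<subseteq> X"
          using inter N(2) X(2) by (intro set_mult_subset_subgroup[OF X(1)]) auto
        finally show ?thesis using X(3) by blast
      qed
    qed
    then show ?thesis
      unfolding maximal_subgroup_in_subgroup_iff[OF sL(1)] using sK(1) KL ne by blast
  qed
  then show ?thesis
    using sK subgroup.subset[OF sM(1)]
    by (auto simp: strictly_2_maximal_def maximal_subgroups_above_def)
qed

end

theorem corollary1p1:
  fixes G :: "('a, 'b) monoid_scheme"
  assumes "group G" and "finite (carrier G)"
  shows "(\<forall>K M. maximal_subgroup M G \<longrightarrow> maximal_subgroup K (G\<lparr>carrier := M\<rparr>) \<longrightarrow>
            core G K \<noteq> core G M \<longrightarrow> strictly_2_maximal K G) \<and>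
         (\<forall>M. maximal_subgroup M G \<longrightarrow> M \<lhd> G \<longrightarrow>
            (\<forall>K. maximal_subgroup K (G\<lparr>carrier := M\<rparr>) \<longrightarrow> strictly_2_maximal K G))"
proof -
  interpret group G by fact
  have sub: "subgroup M G" "subgroup K G" "K \<subset> M"
    if "maximal_subgroup M G" "maximal_subgroup K (G\<lparr>carrier := M\<rparr>)" for K M
    using that maximal_subgroup_in_subgroup_iff[of M K] by (auto simp: maximal_subgroup_def)
  show ?thesis
  proof (intro conjI allI impI)
    fix K M
    assume M: "maximal_subgroup M G" and K: "maximal_subgroup K (G\<lparr>carrier := M\<rparr>)"
      and ne: "core G K \<noteq> core G M"
    note s = sub[OF M K]
    have "\<not> core G M \<subseteq> K"
      using normal_subset_core[OF core_normal[OF s(1)] s(2)] core_mono[OF s(2,1)] s(3) ne by blast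
    then show "strictly_2_maximal K G"
      by (intro strictly_2_maximal_if_normal_not_below[OF M K core_normal[OF s(1)]]
          core_subset[OF s(1)])
  next
    fix K M
    assume M: "maximal_subgroup M G" and K: "maximal_subgroup K (G\<lparr>carrier := M\<rparr>)" and N: "M \<lhd> G"
    show "strictly_2_maximal K G"
      using strictly_2_maximal_if_normal_not_below[OF M K N] sub(3)[OF M K] by blast
  qed
qed

end
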